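(* Let $X=[x_1,\dots,x_n]$ be a finite set of vectors in $\mathbb{R}^m$. If $X$ has an MSS that is intersected nondegenerately and satisfies the non-intersection condition, then the MSS of $X$ satisfying the non-intersection condition is unique (up to reordering of segments).
   Context: A real matrix $X=[x_1,\dots,x_n]$ is identified with the (indexed) finite set of its columns; a subset $X'$ of $X$ is a column submatrix. $r(X')$ and $n(X')$ denote the rank and the number of columns of $X'$, and $\mathrm{span}(X')$ its column space. $X\setminus X'$ denotes the remaining columns of $X$ after removing $X'$. A set $X'$ is nondegenerate if every subset of $X'$ with rank smaller than $r(X')$ is of full column rank. A sample subspace $\mathrm{span}(X')$ (together with its spanning set $X'$) is minimal if (1) $n(X')>r(X')$ and (2) $X'$ is nondegenerate. It is pure if $n(X')=r(X')$. A minimal subspace segmentation (MSS) of $X$ is a partition of the columns of $X$ into nonempty segments $X_0,X_1,\dots,X_K$ ($K\ge 0$; $X_0$ may be absent) such that: (1) $\mathrm{span}(X_0)$ is pure if $X_0$ exists, and each $\mathrm{span}(X_k)$, $k=1,\dots,K$, is minimal; (2) $\mathrm{span}(X_k)\ne\mathrm{span}(X_\ell)$ for all $k\neq\ell$; (3) if $X_0$ exists, then for every $x_j\in X_0$, $x_j\notin\mathrm{span}(X_k)$ for $k=1,\dots,K$. A segmentation satisfies the non-intersection condition if $x_j\notin\mathrm{span}(X_k)\cap\mathrm{span}(X_\ell)$ for all $j$ and all $k\ne\ell$ (indices of all existing segments, including $0$ if $X_0$ exists). A segmentation $\{X_0,\dots,X_K\}$ is intersected nondegenerately if for every $k$ and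 every subset $X_k'$ of $X\setminus X_k$, the following holds: put $\mathcal S_k'=\mathrm{span}(X_k)\cap\mathrm{span}(X_k')$ and let $\mathcal S_k''$ be the orthogonal complement of $\mathcal S_k'$ within $\mathrm{span}(X_k)$; split $X_k=Y_k+Z_k$ columnwise according to $\mathrm{span}(X_k)=\mathcal S_k'\oplus\mathcal S_k''$, with the columns of $Y_k$ in $\mathcal S_k'$ and those of $Z_k$ in $\mathcal S_k''$; then $Z_k$ is either zero or nondegenerate. *)

theory Defs
  imports "HOL-Analysis.Analysis"
begin

(* A matrix is an indexed family x of columns and a column submatrix is a set J of column
   indices; a set of vectors would lose repeated columns, and the number of columns is card J. *)

definition col_span :: "('i \<Rightarrow> 'a::euclidean_space) \<Rightarrow> 'i set \<Rightarrow> 'a set" where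
  "col_span x J = span (x ` J)"

definition col_rank :: "('i \<Rightarrow> 'a::euclidean_space) \<Rightarrow> 'i set \<Rightarrow> nat" where
  "col_rank x J = dim (col_span x J)"

definition full_column_rank :: "('i \<Rightarrow> 'a::euclidean_space) \<Rightarrow> 'i set \<Rightarrow> bool" where
  "full_column_rank x J \<longleftrightarrow> col_rank x J = card J"

definition nondegenerate :: "('i \<Rightarrow> 'a::euclidean_space) \<Rightarrow> 'i set \<Rightarrow> bool" where
  "nondegenerate x J \<longleftrightarrow> (\<forall>I\<subseteq>J. col_rank x I < col_rank x J \<longrightarrow> full_column_rank x I)"

definition minimal_subspace :: "('i \<Rightarrow> 'a::euclidean_space) \<Rightarrow> 'i set \<Rightarrow> bool" where
  "minimal_subspace x J \<longleftrightarrow> card J > col_rank x J \<and> nondegenerate x J"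

definition pure_subspace :: "('i \<Rightarrow> 'a::euclidean_space) \<Rightarrow> 'i set \<Rightarrow> bool" where
  "pure_subspace x J \<longleftrightarrow> card J = col_rank x J"

(* A segmentation is given by K and S, where S k is the set of column indices of the k-th
   segment, k = 0, ..., K. S 0 = {} encodes that the 0-th segment is absent; an absent segment
   has no index in "segments". Values of S beyond K are irrelevant. *)

definition segments :: "nat \<Rightarrow> (nat \<Rightarrow> 'i set) \<Rightarrow> nat set" where
  "segments K S = {k. k \<le> K \<and> (k = 0 \<longrightarrow> S 0 \<noteq> {})}"

definition segmentation :: "'i set \<Rightarrow> nat \<Rightarrow> (nat \<Rightarrow> 'i set) \<Rightarrow> bool" where
  "segmentation J K S \<longleftrightarrow>
     (\<forall>k\<in>segments K S. S k \<noteq> {}) \<and>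
     disjoint_family_on S (segments K S) \<and>
     (\<Union>k\<in>segments K S. S k) = J"

definition MSS ::
    "('i \<Rightarrow> 'a::euclidean_space) \<Rightarrow> 'i set \<Rightarrow> nat \<Rightarrow> (nat \<Rightarrow> 'i set) \<Rightarrow> bool" where
  "MSS x J K S \<longleftrightarrow>
     segmentation J K S \<and>
     (0 \<in> segments K S \<longrightarrow> pure_subspace x (S 0)) \<and>
     (\<forall>k\<in>{1..K}. minimal_subspace x (S k)) \<and>
     (\<forall>k\<in>segments K S. \<forall>l\<in>segments K S. k \<noteq> l \<longrightarrow> col_span x (S k) \<noteq> col_span x (S l)) \<and>
     (0 \<in> segments K S \<longrightarrow> (\<forall>j\<in>S 0. \<forall>k\<in>{1..K}. x j \<notin> col_span x (S k)))"

definition non_intersection ::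
    "('i \<Rightarrow> 'a::euclidean_space) \<Rightarrow> 'i set \<Rightarrow> nat \<Rightarrow> (nat \<Rightarrow> 'i set) \<Rightarrow> bool" where
  "non_intersection x J K S \<longleftrightarrow>
     (\<forall>j\<in>J. \<forall>k\<in>segments K S. \<forall>l\<in>segments K S. k \<noteq> l \<longrightarrow>
        x j \<notin> col_span x (S k) \<inter> col_span x (S l))"

(* x j = y j + z j for j in A is the columnwise splitting of the submatrix A along
   span A = T + T', where T is the intersection of span A with span B and T' is the orthogonal
   complement of T within span A. *)

definition column_split ::
    "('i \<Rightarrow> 'a::euclidean_space) \<Rightarrow> 'i set \<Rightarrow> 'i set \<Rightarrow> ('i \<Rightarrow> 'a) \<Rightarrow> ('i \<Rightarrow> 'a) \<Rightarrow> bool" where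
  "column_split x A B y z \<longleftrightarrow>
     (\<forall>j\<in>A. x j = y j + z j \<and>
        y j \<in> col_span x A \<inter> col_span x B \<and>
        z j \<in> col_span x A \<inter> orthogonal_comp (col_span x A \<inter> col_span x B))"

(* The splitting exists and is unique on the columns of A, so the quantification over y and z in
   "intersected_nondegenerately" ranges over exactly one splitting. *)

lemma column_split_exists: "\<exists>y z. column_split x A B y z"
proof -
  define T where "T = col_span x A \<inter> col_span x B"
  have T: "span T = T" and A: "subspace (col_span x A)"
    unfolding T_def by (simp_all add: col_span_def subspace_inter span_eq_iff)
  have "\<exists>u v. j \<in> A \<longrightarrow> x j = u + v \<and> u \<in> T \<and> v \<in> col_span x A \<inter> orthogonal_comp T" for j
  proof (cases "j \<in> A")
    case True
    obtain u v where u: "u \<in> T" and v: "\<And>w. w \<in> T \<Longrightarrow> orthogonal v w" and x: "x j = u + v"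
      using orthogonal_subspace_decomp_exists[of T "x j"] unfolding T by blast
    have "x j - u \<in> col_span x A"
    proof (rule subspace_diff[OF A])
      show "x j \<in> col_span x A"
        using True by (simp add: col_span_def span_base)
      show "u \<in> col_span x A"
        using u by (simp add: T_def)
    qed
    then have "v \<in> col_span x A"
      using x by simp
    moreover have "v \<in> orthogonal_comp T"
      using v by (simp add: orthogonal_comp_def orthogonal_commute)
    ultimately show ?thesis
      using u x by blast
  qed simp
  then obtain y where "\<And>j. \<exists>v. j \<in> A \<longrightarrow>
      x j = y j + v \<and> y j \<in> T \<and> v \<in> col_span x A \<inter> orthogonal_comp T"
    by (metis (no_types))
  then obtain z where "\<And>j. j \<in> A \<longrightarrow>
      x j = y j + z j \<and> y j \<in> T \<and> z j \<in> col_span x A \<inter> orthogonal_comp T"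
    by (metis (no_types))
  then show ?thesis
    unfolding column_split_def T_def by blast
qed

lemma column_split_unique:
  assumes "column_split x A B y z" "column_split x A B y' z'" "j \<in> A"
  shows "y j = y' j \<and> z j = z' j"
proof (rule orthogonal_subspace_decomp_unique)
  let ?T = "col_span x A \<inter> col_span x B"
  show "y j + z j = y' j + z' j"
    using assms unfolding column_split_def by metis
  show "y j \<in> span ?T" "y' j \<in> span ?T"
    using assms unfolding column_split_def by (auto intro: span_base)
  show "z j \<in> span (orthogonal_comp ?T)" "z' j \<in> span (orthogonal_comp ?T)"
    using assms unfolding column_split_def by (auto intro: span_base)
  show "orthogonal a b" if "a \<in> ?T" "b \<in> orthogonal_comp ?T" for a b
    using that unfolding orthogonal_comp_def by blast
qed

definition intersected_nondegenerately ::
    "('i \<Rightarrow> 'a::euclidean_space) \<Rightarrow> 'i set \<Rightarrow> nat \<Rightarrow> (nat \<Rightarrow> 'i set) \<Rightarrow> bool" where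
  "intersected_nondegenerately x J K S \<longleftrightarrow>
     (\<forall>k\<in>segments K S. \<forall>B\<subseteq>J - S k. \<forall>y z. column_split x (S k) B y z \<longrightarrow>
        (\<forall>j\<in>S k. z j = 0) \<or> nondegenerate z (S k))"

definition same_up_to_reordering ::
    "nat \<Rightarrow> (nat \<Rightarrow> 'i set) \<Rightarrow> nat \<Rightarrow> (nat \<Rightarrow> 'i set) \<Rightarrow> bool" where
  "same_up_to_reordering K S K' S' \<longleftrightarrow>
     S 0 = S' 0 \<and> (\<exists>p. bij_betw p {1..K} {1..K'} \<and> (\<forall>k\<in>{1..K}. S k = S' (p k)))"

end

theory Submission
  imports Defs
begin

text \<open>
  Let \<open>S\<close> be the nondegenerately intersected segmentation and \<open>P\<close> a minimal segment of another one.
  For \<open>j \<in> P\<close>, nondegeneracy gives \<open>x j \<in> span (P - {j})\<close>. If \<open>j \<in> S k\<close>, then modulo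
  \<open>T = span (S k) \<inter> span (P - S k)\<close> this is a linear dependence among the columns of \<open>P \<inter> S k\<close>,
  so by the hypothesis these columns span \<open>S k\<close> modulo \<open>T\<close>, whence \<open>S k \<subseteq> span P\<close> and, by
  non-intersection, \<open>S k \<subseteq> P\<close>. For \<open>k \<ge> 1\<close> the set \<open>S k\<close> is dependent, so nondegeneracy of \<open>P\<close>
  forces the spans to coincide and \<open>P = S k\<close>. The pure segments contain no dependent set,
  which excludes all other cases.
\<close>

section \<open>Rank, span and nondegeneracy of column submatrices\<close>

lemma subspace_col_span [simp]: "subspace (col_span x J)"
  by (simp add: col_span_def)

lemma col_in_col_span: "j \<in> J \<Longrightarrow> x j \<in> col_span x J"
  by (simp add: col_span_def span_base)

lemma col_span_mono: "I \<subseteq> J \<Longrightarrow> col_span x I \<subseteq> col_span x J"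
  by (simp add: col_span_def image_mono span_mono)

lemma col_span_subset_iff: "col_span x I \<subseteq> V \<longleftrightarrow> x ` I \<subseteq> V" if "subspace V"
  unfolding col_span_def using that by (meson span_minimal span_superset subset_trans)

lemma col_rank_le_card: "finite J \<Longrightarrow> col_rank x J \<le> card J"
  unfolding col_rank_def col_span_def dim_span
  by (metis card_image_le dim_le_card' finite_imageI le_trans)

lemma col_span_eq_of_rank:
  assumes "I \<subseteq> J" "col_rank x J \<le> col_rank x I"
  shows "col_span x I = col_span x J"
  using assms unfolding col_rank_def
  by (metis subspace_col_span subspace_dim_equal col_span_mono)

text \<open>A dependent subset cannot have smaller rank, and equal rank under inclusion means equal
  span. Later this is applied to columns \<open>x\<close> as well as to residual columns
  \<open>z\<close>.\<close>

lemma nondegenerate_span_eq: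
  assumes "nondegenerate x J" "I \<subseteq> J" "\<not> full_column_rank x I"
  shows "col_span x I = col_span x J"
  using assms col_span_eq_of_rank unfolding nondegenerate_def by (metis not_le)

lemma col_span_Un: "col_span x (I \<union> J) = {a + b |a b. a \<in> col_span x I \<and> b \<in> col_span x J}"
  by (simp add: col_span_def image_Un span_Un)

lemma not_full_column_rank_if_in_span:
  assumes "finite J" "j \<in> J" "x j \<in> col_span x (J - {j})"
  shows "\<not> full_column_rank x J"
proof -
  have "x ` J \<subseteq> col_span x (J - {j})"
    using assms(3) by (auto intro: col_in_col_span)
  then have "col_span x J \<subseteq> col_span x (J - {j})"
    by (simp add: col_span_subset_iff)
  then have "col_rank x J \<le> col_rank x (J - {j})"
    by (simp add: col_rank_def dim_subset)
  also have "\<dots> \<le> card (J - {j})"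
    using assms(1) by (simp add: col_rank_le_card)
  also have "\<dots> < card J"
    using assms(1,2) by (rule card_Diff1_less)
  finally show ?thesis
    by (simp add: full_column_rank_def)
qed

text \<open>Rank is subadditive over \<open>I\<close> and \<open>J - I\<close> and bounded by the
  size of each, so equality for \<open>J\<close> forces equality for both parts.\<close>

lemma full_column_rank_subset:
  assumes "finite J" "full_column_rank x J" "I \<subseteq> J"
  shows "full_column_rank x I"
proof -
  have "col_rank x J \<le> col_rank x I + col_rank x (J - I)"
  proof -
    have "col_rank x (I \<union> (J - I)) \<le> col_rank x I + col_rank x (J - I)"
      using dim_sums_Int[of "col_span x I" "col_span x (J - I)"]
      by (simp add: col_rank_def col_span_Un del: Un_Diff_cancel)
    then show ?thesis
      using assms(3) by (simp add: Un_absorb1)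
  qed
  moreover have "card J = card I + card (J - I)"
    using assms by (metis card_Diff_subset card_mono finite_subset le_add_diff_inverse)
  moreover have "col_rank x I \<le> card I" "col_rank x (J - I) \<le> card (J - I)"
    using assms by (auto intro: col_rank_le_card finite_subset)
  ultimately show ?thesis
    using assms(2) by (simp add: full_column_rank_def)
qed

lemma minimal_subspace_not_full: "minimal_subspace x J \<Longrightarrow> \<not> full_column_rank x J"
  by (simp add: minimal_subspace_def full_column_rank_def)

lemma minimal_subspace_col_in_span:
  assumes "minimal_subspace x J" "j \<in> J"
  shows "x j \<in> col_span x (J - {j})"
proof -
  have "card (J - {j}) \<ge> col_rank x J"
    using assms by (auto simp: minimal_subspace_def)
  \<comment> \<open>If the rank dropped, nondegeneracy would give \<open>J - {j}\<close> the rank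
    \<open>card (J - {j})\<close>, which is at least \<open>col_rank x J\<close>.\<close>
  then have "col_rank x (J - {j}) \<ge> col_rank x J"
    using assms unfolding minimal_subspace_def nondegenerate_def full_column_rank_def
    by (metis Diff_subset not_le)
  then have "col_span x (J - {j}) = col_span x J"
    by (intro col_span_eq_of_rank) auto
  then show ?thesis
    using assms(2) by (simp add: col_in_col_span)
qed

section \<open>Column splittings and dependence modulo an intersection of spans\<close>

lemma col_span_lift:
  assumes T: "subspace T" and "\<And>j. j \<in> I \<Longrightarrow> x j - z j \<in> T" and "a \<in> col_span x I"
  shows "\<exists>w \<in> col_span z I. a - w \<in> T"
  using assms(3) unfolding col_span_def
proof (induction rule: span_induct_alt)
  case base
  show ?case
    using T by (intro bexI[of _ 0]) (auto simp: subspace_0 span_zero)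
next
  case (step c v b)
  then obtain w i where w: "w \<in> span (z ` I)" "b - w \<in> T" and i: "i \<in> I" "v = x i"
    by blast
  \<comment> \<open>The combination keeps its coefficients and replaces \<open>x i\<close> by
    \<open>z i\<close>, which changes it only by an element of \<open>T\<close>.\<close>
  have "c *\<^sub>R (v - z i) + (b - w) \<in> T"
    using T w i assms(2) by (simp add: subspace_add subspace_mul)
  then have "c *\<^sub>R v + b - (c *\<^sub>R z i + w) \<in> T"
    by (simp add: algebra_simps)
  moreover have "c *\<^sub>R z i + w \<in> span (z ` I)"
    using w i by (simp add: span_add span_mul span_base)
  ultimately show ?case
    by blast
qed

text \<open>Modulo the intersection of the two spans, \<open>z j\<close> agrees with
  \<open>x j\<close>, hence with a combination of the \<open>z i\<close> for
  \<open>i \<in> I\<close>. Both are orthogonal to the intersection, so the agreement is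
  exact.\<close>

lemma column_split_dependent:
  assumes split: "column_split x A B y z" and I: "I \<subseteq> A" and j: "j \<in> A"
    and dep: "x j \<in> col_span x (I \<union> B)"
  shows "z j \<in> col_span z I"
proof -
  let ?T = "col_span x A \<inter> col_span x B"
  have T: "subspace ?T"
    by (simp add: subspace_inter)
  have diff: "x i - z i \<in> ?T" if "i \<in> A" for i
    using split that unfolding column_split_def by (metis add_diff_cancel_right')
  obtain a b where a: "a \<in> col_span x I" and b: "b \<in> col_span x B" and xj: "x j = a + b"
    using dep by (auto simp: col_span_Un)
  obtain w where w: "w \<in> col_span z I" and aw: "a - w \<in> ?T"
    using col_span_lift[OF T _ a, of z] diff I by blast
  have "a \<in> col_span x A"
    using a I col_span_mono by blast
  \<comment> \<open>\<open>x j - a\<close> equals \<open>b\<close>, so it lies in the span of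
    \<open>B\<close>; it lies in the span of \<open>A\<close> because \<open>x j\<close> and
    \<open>a\<close> do.\<close>
  then have "x j - a \<in> ?T"
    using b xj j by (metis IntI add_diff_cancel_left' col_in_col_span subspace_col_span subspace_diff)
  then have "(x j - a) + (a - w) - (x j - z j) \<in> ?T"
    using aw diff[OF j] T by (metis subspace_add subspace_diff)
  then have zw: "z j - w \<in> ?T"
    by simp
  have orth: "subspace (orthogonal_comp ?T)"
    by (simp add: subspace_orthogonal_comp)
  have "z ` I \<subseteq> orthogonal_comp ?T"
    using split I unfolding column_split_def by blast
  then have "w \<in> orthogonal_comp ?T"
    using w orth col_span_subset_iff by blast
  moreover have "z j \<in> orthogonal_comp ?T"
    using split j unfolding column_split_def by blast
  ultimately have "z j - w \<in> orthogonal_comp ?T"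
    using orth by (simp add: subspace_diff)
  then have "orthogonal (z j - w) (z j - w)"
    using zw unfolding orthogonal_comp_def by blast
  then show ?thesis
    using w by (simp add: orthogonal_self)
qed

text \<open>For \<open>i \<in> I\<close>, \<open>z i\<close> is \<open>x i - y i\<close> with
  \<open>y i\<close> in the span of \<open>B\<close>. So the span of \<open>I \<union> B\<close>
  contains these residuals, then all residuals, then all columns of \<open>A\<close>.\<close>

lemma column_split_span:
  assumes split: "column_split x A B y z" and I: "I \<subseteq> A" and z: "z ` A \<subseteq> col_span z I"
  shows "col_span x A \<subseteq> col_span x (I \<union> B)"
proof -
  let ?V = "col_span x (I \<union> B)"
  have sub: "col_span x I \<subseteq> ?V" "col_span x B \<subseteq> ?V"
    by (simp_all add: col_span_mono)
  have y: "y i \<in> ?V" and x: "x i = y i + z i" if "i \<in> A" for i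
    using split that sub unfolding column_split_def by blast+
  have "z i \<in> ?V" if "i \<in> I" for i
  proof -
    have "x i - y i \<in> ?V"
      using that y I by (intro subspace_diff) (auto intro: col_in_col_span)
    then show ?thesis
      using x[of i] that I by auto
  qed
  then have "col_span z I \<subseteq> ?V"
    by (subst col_span_subset_iff) auto
  then have "x i \<in> ?V" if "i \<in> A" for i
    using x[OF that] y[OF that] z that by (metis image_subset_iff subsetD subspace_add subspace_col_span)
  then show ?thesis
    by (subst col_span_subset_iff) auto
qed

lemma col_span_subset_of_minimal:
  assumes nd: "intersected_nondegenerately x J K S" and k: "k \<in> segments K S"
    and P: "minimal_subspace x P" "P \<subseteq> J" "finite P" and j: "j \<in> P" "j \<in> S k"
  shows "col_span x (S k) \<subseteq> col_span x P"
proof -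
  let ?A = "P \<inter> S k" and ?B = "P - S k"
  obtain y z where split: "column_split x (S k) ?B y z"
    using column_split_exists by blast
  have "x j \<in> col_span x ((?A - {j}) \<union> ?B)"
  proof -
    have "(?A - {j}) \<union> ?B = P - {j}"
      using j by blast
    then show ?thesis
      using minimal_subspace_col_in_span[OF P(1) j(1)] by simp
  qed
  then have "z j \<in> col_span z (?A - {j})"
    using column_split_dependent[OF split, of "?A - {j}" j] j by blast
  then have nfull: "\<not> full_column_rank z ?A"
    using not_full_column_rank_if_in_span[of ?A j z] P j by simp
  have "?B \<subseteq> J - S k"
    using P by blast
  then consider "\<forall>i\<in>S k. z i = 0" | "nondegenerate z (S k)"
    using nd k split unfolding intersected_nondegenerately_def by blast
  \<comment> \<open>Zero residuals lie in any span; otherwise \<open>?A\<close> is a dependent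
    subset of a nondegenerate family and spans it.\<close>
  then have "z ` S k \<subseteq> col_span z ?A"
  proof cases
    case 1
    then show ?thesis
      by (auto simp: subspace_0)
  next
    case 2
    then have "col_span z ?A = col_span z (S k)"
      using nfull nondegenerate_span_eq by blast
    then show ?thesis
      by (auto intro: col_in_col_span)
  qed
  then have "col_span x (S k) \<subseteq> col_span x (?A \<union> ?B)"
    using column_split_span[OF split] by blast
  also have "?A \<union> ?B = P"
    by blast
  finally show ?thesis .
qed

section \<open>Structure of a minimal subspace segmentation\<close>

lemma segments_ge_1: "k \<in> {1..K} \<Longrightarrow> k \<in> segments K S"
  by (simp add: segments_def)

lemma segments_cases: "k \<in> segments K S \<Longrightarrow> (k = 0 \<and> S 0 \<noteq> {}) \<or> k \<in> {1..K}"
  by (auto simp: segments_def)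

lemma MSS_obtain_segment:
  assumes "MSS x J K S" "j \<in> J"
  obtains k where "k \<in> segments K S" "j \<in> S k"
  using assms unfolding MSS_def segmentation_def by blast

lemma MSS_segment_subset:
  assumes "MSS x J K S" "k \<in> segments K S"
  shows "S k \<subseteq> J"
  using assms unfolding MSS_def segmentation_def by blast

lemma MSS_disjoint:
  assumes "MSS x J K S" "k \<in> segments K S" "l \<in> segments K S" "j \<in> S k" "j \<in> S l"
  shows "k = l"
  using assms unfolding MSS_def segmentation_def disjoint_family_on_def by blast

lemma MSS_minimal: "MSS x J K S \<Longrightarrow> k \<in> {1..K} \<Longrightarrow> minimal_subspace x (S k)"
  by (simp add: MSS_def)

lemma MSS_segment_0_full:
  assumes "MSS x J K S"
  shows "full_column_rank x (S 0)"
proof (cases "S 0 = {}")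
  \<comment> \<open>An absent segment is the empty set, of rank and size 0.\<close>
  case True
  then show ?thesis
    by (simp add: full_column_rank_def col_rank_def col_span_def)
next
  case False
  then show ?thesis
    using assms by (simp add: MSS_def segments_def pure_subspace_def full_column_rank_def)
qed

text \<open>Minimal subspaces are dependent, while every part of the pure segment is
  independent.\<close>

lemma MSS_minimal_not_subset_segment_0:
  assumes S: "MSS x J K S" and J: "finite J" and P: "minimal_subspace x P"
  shows "\<not> P \<subseteq> S 0"
proof
  assume P0: "P \<subseteq> S 0"
  have "finite (S 0)"
  proof (cases "S 0 = {}")
    case False
    then have "S 0 \<subseteq> J"
      by (intro MSS_segment_subset[OF S]) (simp add: segments_def)
    then show ?thesis
      using J finite_subset by blast
  qed simp
  then show False
    using P0 P MSS_segment_0_full[OF S] full_column_rank_subset minimal_subspace_not_full by blast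
qed

text \<open>The pure segment is determined by the others, so only minimal segments have to be
  compared. It is absent exactly when the others exhaust \<open>J\<close>.\<close>

lemma MSS_segment_0: "MSS x J K S \<Longrightarrow> S 0 = J - (\<Union>k\<in>{1..K}. S k)"
proof (intro equalityI subsetI)
  fix j assume S: "MSS x J K S" and j: "j \<in> S 0"
  then have 0: "0 \<in> segments K S"
    by (auto simp: segments_def)
  have "j \<notin> S k" if "k \<in> {1..K}" for k
    using MSS_disjoint[OF S 0 segments_ge_1[OF that] j] that by auto
  then show "j \<in> J - (\<Union>k\<in>{1..K}. S k)"
    using MSS_segment_subset[OF S 0] j by blast
next
  fix j assume S: "MSS x J K S" and "j \<in> J - (\<Union>k\<in>{1..K}. S k)"
  then show "j \<in> S 0"
    by (metis DiffD1 DiffD2 MSS_obtain_segment UN_I segments_cases)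
qed

text \<open>Segments are nonempty and disjoint. This later turns an equality of images into a
  bijection of indices.\<close>

lemma MSS_inj_on:
  assumes S: "MSS x J K S"
  shows "inj_on S {1..K}"
proof (rule inj_onI)
  fix k l assume k: "k \<in> {1..K}" and l: "l \<in> {1..K}" and eq: "S k = S l"
  have "S k \<noteq> {}"
    using S segments_ge_1[OF k] unfolding MSS_def segmentation_def by blast
  then show "k = l"
    using MSS_disjoint[OF S segments_ge_1[OF k] segments_ge_1[OF l]] eq by blast
qed

text \<open>A column lies in the span of its own segment, so no other segment can have it in its
  span. Inclusions of spans thereby become inclusions of segments.\<close>

lemma non_intersection_mem:
  assumes S: "MSS x J K S" "non_intersection x J K S" and k: "k \<in> segments K S"
    and j: "j \<in> J" "x j \<in> col_span x (S k)"
  shows "j \<in> S k"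
proof -
  obtain l where l: "l \<in> segments K S" "j \<in> S l"
    using MSS_obtain_segment[OF S(1) j(1)] .
  have "x j \<in> col_span x (S l)"
    using l by (simp add: col_in_col_span)
  then have "l = k"
    using S(2) j k l unfolding non_intersection_def by blast
  then show ?thesis
    using l by simp
qed

section \<open>Matching the segments of two segmentations\<close>

lemma minimal_segments_equal:
  assumes S: "MSS x J K S" "intersected_nondegenerately x J K S" "non_intersection x J K S"
    and S': "MSS x J K' S'" "non_intersection x J K' S'" and J: "finite J"
    and k: "k \<in> {1..K}" and l: "l \<in> {1..K'}" and j: "j \<in> S k" "j \<in> S' l"
  shows "S k = S' l"
proof -
  note ks = segments_ge_1[OF k, of S] and ls = segments_ge_1[OF l, of S']
  note SJ = MSS_segment_subset[OF S(1) ks] and SJ' = MSS_segment_subset[OF S'(1) ls]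
  note min = MSS_minimal[OF S'(1) l]
  \<comment> \<open>From the one shared column \<open>j\<close>, intersected nondegeneracy of
    \<open>S\<close> pulls all of \<open>S k\<close> into the span of \<open>S' l\<close>.\<close>
  have sub: "col_span x (S k) \<subseteq> col_span x (S' l)"
    using col_span_subset_of_minimal[OF S(2) ks min SJ' _ j(2,1)] SJ' J finite_subset by blast
  have 1: "S k \<subseteq> S' l"
    using sub SJ by (auto intro!: non_intersection_mem[OF S' ls] dest: col_in_col_span[of _ _ x])
  \<comment> \<open>\<open>S k\<close> is a dependent subset of the nondegenerate
    \<open>S' l\<close>.\<close>
  have "col_span x (S k) = col_span x (S' l)"
    using nondegenerate_span_eq[OF _ 1] min minimal_subspace_not_full[OF MSS_minimal[OF S(1) k]]
    unfolding minimal_subspace_def by blast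
  then have "S' l \<subseteq> S k"
    using SJ' by (auto intro!: non_intersection_mem[OF S(1,3) ks] simp: col_in_col_span)
  with 1 show ?thesis
    by blast
qed

text \<open>Supplies the shared column: \<open>P\<close> does not fit into the pure segment, and a
  column outside it belongs to a minimal one.\<close>

lemma MSS_minimal_meets:
  assumes S: "MSS x J K S" and J: "finite J" and P: "minimal_subspace x P" "P \<subseteq> J"
  obtains k j where "k \<in> {1..K}" "j \<in> S k" "j \<in> P"
proof -
  obtain j where j: "j \<in> P" "j \<notin> S 0"
    using MSS_minimal_not_subset_segment_0[OF S J P(1)] by blast
  moreover obtain k where "k \<in> segments K S" "j \<in> S k"
    using MSS_obtain_segment[OF S] P(2) j(1) by blast
  ultimately show ?thesis
    using that segments_cases by metis
qed

lemma minimal_segments_image_eq: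
  assumes S: "MSS x J K S" "intersected_nondegenerately x J K S" "non_intersection x J K S"
    and S': "MSS x J K' S'" "non_intersection x J K' S'" and J: "finite J"
  shows "S ` {1..K} = S' ` {1..K'}"
proof (intro equalityI image_subsetI)
  fix k assume k: "k \<in> {1..K}"
  obtain l j where "l \<in> {1..K'}" "j \<in> S' l" "j \<in> S k"
    using MSS_minimal_meets[OF S'(1) J MSS_minimal[OF S(1) k]]
      MSS_segment_subset[OF S(1) segments_ge_1[OF k]] by blast
  then show "S k \<in> S' ` {1..K'}"
    using minimal_segments_equal[OF S S' J k] by blast
next
  fix l assume l: "l \<in> {1..K'}"
  obtain k j where "k \<in> {1..K}" "j \<in> S k" "j \<in> S' l"
    using MSS_minimal_meets[OF S(1) J MSS_minimal[OF S'(1) l]]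
      MSS_segment_subset[OF S'(1) segments_ge_1[OF l]] by blast
  then show "S' l \<in> S ` {1..K}"
    using minimal_segments_equal[OF S S' J _ l] by (metis image_eqI)
qed

lemma same_up_to_reordering_if_image_eq:
  assumes S: "MSS x J K S" and S': "MSS x J K' S'" and eq: "S ` {1..K} = S' ` {1..K'}"
  shows "same_up_to_reordering K S K' S'"
proof -
  \<comment> \<open>\<open>?p k\<close> is the index in \<open>{1..K'}\<close> at which
    \<open>S'\<close> takes the value \<open>S k\<close>.\<close>
  let ?p = "inv_into {1..K'} S' \<circ> S"
  have "bij_betw S {1..K} (S' ` {1..K'})"
    using MSS_inj_on[OF S] eq by (simp add: bij_betw_def)
  moreover have "bij_betw (inv_into {1..K'} S') (S' ` {1..K'}) {1..K'}"
    using MSS_inj_on[OF S'] by (simp add: bij_betw_inv_into inj_on_imp_bij_betw)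
  ultimately have "bij_betw ?p {1..K} {1..K'}"
    by (rule bij_betw_trans)
  moreover have "S k = S' (?p k)" if "k \<in> {1..K}" for k
    using eq that by (metis comp_apply f_inv_into_f imageI)
  moreover have "S 0 = S' 0"
    using MSS_segment_0[OF S] MSS_segment_0[OF S'] eq by simp
  ultimately show ?thesis
    unfolding same_up_to_reordering_def by blast
qed

theorem theorem3:
  fixes x :: "nat \<Rightarrow> real ^ 'm" and n :: nat
  assumes "\<exists>K S. MSS x {1..n} K S \<and> intersected_nondegenerately x {1..n} K S \<and>
                 non_intersection x {1..n} K S"
  shows "\<exists>K S. MSS x {1..n} K S \<and> non_intersection x {1..n} K S \<and>
           (\<forall>K' S'. MSS x {1..n} K' S' \<and> non_intersection x {1..n} K' S' \<longrightarrow>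
              same_up_to_reordering K' S' K S)"
proof -
  obtain K S where S: "MSS x {1..n} K S" "intersected_nondegenerately x {1..n} K S"
      "non_intersection x {1..n} K S"
    using assms by blast
  \<comment> \<open>The given segmentation is the witness; the image equation for \<open>S\<close>
    and \<open>S'\<close> is read from right to left.\<close>
  have "same_up_to_reordering K' S' K S"
    if S': "MSS x {1..n} K' S'" "non_intersection x {1..n} K' S'" for K' S'
    using same_up_to_reordering_if_image_eq[OF S'(1) S(1)] minimal_segments_image_eq[OF S S'] by simp
  then show ?thesis
    using S by blast
qed

end
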